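(* Let $a,b,c$ be integers with $2\le a<b<c$, $\gcd(a,b,c)=1$ and $c\ne a+b$; put $S=\{a,b,c\}$ and $B=\{a,b\}$. Let $P\in\{c+a,\,c+b\}$ and suppose $\mathcal W_0(S)=T_P$. Let $N,w_B,N_c,D_\rho$ be as defined in the context, and put $E=\varnothing$ if $P=c+a$ and $E=D_\rho$ if $P=c+b$. Then $$\mathcal W_0(S)\cap[0,P)=\{w_B(n):0\le n<N_c\}\ \sqcup\ (c+E).$$ Put $M=N_c+|E|$ and let $\tau_0<\dots<\tau_{|E|-1}$ be the elements of $E$. The increasing list of $\mathcal W_0(S)\cap[0,P)$ is $$v(t)=\begin{cases}w_B(t),&0\le t<N_c,\\ c+\tau_{t-N_c},&N_c\le t<M,\end{cases}$$ and for every $n\in\mathbb N$ the $n$-th $\mathrm P$-position of $S$ (the $n$-th element of $\mathcal W_0(S)$ in increasing order, indexed from $n=0$) is $$w(n)=P\Big\lfloor\frac nM\Big\rfloor+v(n\bmod M).$$ If instead $\mathcal W_0(S)=\mathcal W_0(B)$, then the $n$-th $\mathrm P$-position of $S$ is $w(n)=w_B(n)$ for every $n\in\mathbb N$.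
   Context: $\mathbb N=\{0,1,2,\dots\}$. For a finite nonempty set $S$ of positive integers, the subtraction game $S$ has positions $x\in\mathbb N$ and legal moves $x\mapsto x-s$ for $s\in S$, $s\le x$; a player unable to move loses. The nim-value is $\mathcal G_S(x)=\operatorname{mex}\{\mathcal G_S(x-s):s\in S,\ s\le x\}$, where mex is the least non-negative integer not in the set, and $\mathcal W_0(S)=\{x\in\mathbb N:\mathcal G_S(x)=0\}$ is the set of $\mathrm P$-positions. Integer intervals: $[u,v)=\{u,\dots,v-1\}$. For $P\ge c$, $T_P=\{x\in\mathbb N:(x\bmod P)\in\mathcal W_0(B)\text{ and }(x\bmod P)-c\notin\mathcal W_0(B)\}$, with the convention $y\notin\mathcal W_0(B)$ for $y<0$. Notation: $\mathcal Z=\mathcal W_0(B)\cap[0,a+b)$; $D=[a,b)\setminus\mathcal Z$; $\rho=c\bmod(a+b)$; $K=\lfloor c/(a+b)\rfloor$. For an integer $t\ge0$, $C_a(t)=a\lfloor t/(2a)\rfloor+\min(a,\,t\bmod 2a)$; $N=C_a(b)$. $w_1(n)=n+a\lfloor n/a\rfloor$ and $w_B(n)=(a+b)\lfloor n/N\rfloor+w_1(n\bmod N)$ (also written $w_2$ in the paper). $N_c=KN+C_a(\min(\rho,b))$. $D_\rho=\{u\in D:(\rho+u)\bmod(a+b)\in\mathcal Z\}$. For $E\subseteq\mathbb N$, $c+E=\{c+u:u\in E\}$. *)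

theory Defs
  imports Main "HOL-Library.Infinite_Set"
begin

definition mex :: "nat set \<Rightarrow> nat" where
  "mex A = (LEAST n. n \<notin> A)"

text \<open>The guard \<open>0 < s\<close> only serves termination; it is vacuous for a set of positive integers.\<close>

function nim_value :: "nat set \<Rightarrow> nat \<Rightarrow> nat" where
  "nim_value S x = mex ((\<lambda>s. nim_value S (x - s)) ` {s \<in> S. 0 < s \<and> s \<le> x})"
  by pat_completeness auto
termination
  by (relation "measure snd") auto

declare nim_value.simps [simp del]

definition P_positions :: "nat set \<Rightarrow> nat set" where
  "P_positions S = {x. nim_value S x = 0}"

text \<open>The set \<open>T\<^sub>P\<close>. The test \<open>c \<le> x mod P\<close> keeps truncated subtraction from turning a
  negative difference into \<open>0\<close>, which would be a P-position.\<close>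

definition T_set :: "nat \<Rightarrow> nat \<Rightarrow> nat \<Rightarrow> nat \<Rightarrow> nat set" where
  "T_set a b c P = {x. x mod P \<in> P_positions {a, b} \<and>
     \<not> (c \<le> x mod P \<and> x mod P - c \<in> P_positions {a, b})}"

definition Z_set :: "nat \<Rightarrow> nat \<Rightarrow> nat set" where
  "Z_set a b = P_positions {a, b} \<inter> {0..<a + b}"

definition D_set :: "nat \<Rightarrow> nat \<Rightarrow> nat set" where
  "D_set a b = {a..<b} - Z_set a b"

definition rho :: "nat \<Rightarrow> nat \<Rightarrow> nat \<Rightarrow> nat" where
  "rho a b c = c mod (a + b)"

definition K_quot :: "nat \<Rightarrow> nat \<Rightarrow> nat \<Rightarrow> nat" where
  "K_quot a b c = c div (a + b)"

text \<open>\<open>C_count a t\<close> is the number of \<open>x < t\<close> with \<open>x mod (2 * a) < a\<close>, that is, of P-positions of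
  the game \<open>{a}\<close> below \<open>t\<close>; \<open>w1 a n\<close> below is the \<open>n\<close>-th such position.\<close>

definition C_count :: "nat \<Rightarrow> nat \<Rightarrow> nat" where
  "C_count a t = a * (t div (2 * a)) + min a (t mod (2 * a))"

definition N_count :: "nat \<Rightarrow> nat \<Rightarrow> nat" where
  "N_count a b = C_count a b"

definition w1 :: "nat \<Rightarrow> nat \<Rightarrow> nat" where
  "w1 a n = n + a * (n div a)"

definition w_B :: "nat \<Rightarrow> nat \<Rightarrow> nat \<Rightarrow> nat" where
  "w_B a b n = (a + b) * (n div N_count a b) + w1 a (n mod N_count a b)"

definition Nc_count :: "nat \<Rightarrow> nat \<Rightarrow> nat \<Rightarrow> nat" where
  "Nc_count a b c = K_quot a b c * N_count a b + C_count a (min (rho a b c) b)"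

definition D_rho :: "nat \<Rightarrow> nat \<Rightarrow> nat \<Rightarrow> nat set" where
  "D_rho a b c = {u \<in> D_set a b. (rho a b c + u) mod (a + b) \<in> Z_set a b}"

text \<open>\<open>sorted_list_of_set E ! i\<close> is the element \<open>\<tau>\<^sub>i\<close> of the finite set \<open>E\<close>; the value is
  meaningful only for \<open>t < Nc_count a b c + card E\<close>.\<close>

definition v_list :: "nat \<Rightarrow> nat \<Rightarrow> nat \<Rightarrow> nat set \<Rightarrow> nat \<Rightarrow> nat" where
  "v_list a b c E t = (if t < Nc_count a b c then w_B a b t
     else c + sorted_list_of_set E ! (t - Nc_count a b c))"

end

theory Submission
  imports Defs
begin

text \<open>The P-positions of \<open>{a, b}\<close> with \<open>a < b\<close> are the \<open>x\<close> whose residue \<open>r\<close> modulo \<open>a + b\<close>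
  satisfies \<open>r < b\<close> and \<open>r mod 2a < a\<close>. A set of period \<open>p\<close> is enumerated by listing its
  elements below \<open>p\<close> and translating, which with the blocks of length \<open>2a\<close> gives \<open>w1\<close> and then,
  with period \<open>a + b\<close>, gives \<open>w_B\<close>. Below \<open>c\<close> the set \<open>T_set\<close> agrees with the P-positions of
  \<open>{a, b}\<close>; at \<open>c + u\<close> with \<open>u < P - c \<le> b\<close> membership means that \<open>u\<close> is not a P-position of
  \<open>{a, b}\<close> and \<open>c + u\<close> is one, so \<open>u\<close> lies in \<open>D_rho\<close>, and no such \<open>u\<close> is below \<open>a\<close>.\<close>

subsection \<open>Enumeration of periodic sets\<close>

text \<open>\<open>enumerate\<close> always takes the least element above the previous one; for a
  strictly increasing \<open>f\<close> this is \<open>f 0\<close>, then each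
  \<open>f (Suc n)\<close>.\<close>

lemma enumerate_eq_strict_mono:
  fixes f :: "nat \<Rightarrow> nat"
  assumes "strict_mono f" "range f = A"
  shows "infinite A" "enumerate A n = f n"
proof -
  show inf: "infinite A"
    using assms range_inj_infinite strict_mono_imp_inj_on by blast
  show "enumerate A n = f n"
  proof (induction n)
    case 0
    show ?case
      unfolding enumerate_0
      by (rule Least_equality) (use assms in \<open>auto simp: strict_mono_less_eq\<close>)
  next
    case (Suc n)
    show ?case
      unfolding enumerate_Suc''[OF inf] Suc
      by (rule Least_equality)
        (use assms in \<open>auto simp: strict_mono_less strict_mono_less_eq Suc_le_eq\<close>)
  qed
qed

text \<open>Since \<open>enumerate A\<close> is increasing, the indices of the elements below
  \<open>t\<close> form an initial segment of the naturals, which is determined by its size.\<close>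

lemma sorted_list_of_set_lessThan_enumerate:
  fixes A :: "nat set"
  assumes "infinite A"
  shows "sorted_list_of_set (A \<inter> {..<t}) = map (enumerate A) [0..<card (A \<inter> {..<t})]"
proof -
  define J where "J = {n. enumerate A n < t}"
  have J: "enumerate A ` J = A \<inter> {..<t}"
    using range_enumerate[OF assms] unfolding J_def by auto
  have "J \<subseteq> {..<t}"
    unfolding J_def using le_enumerate[OF assms] le_less_trans by blast
  then have "finite J"
    using finite_subset by blast
  moreover have "n \<in> J" if "m \<in> J" "n < m" for m n
    using that enumerate_mono[OF that(2) assms] unfolding J_def by simp
  ultimately have "J = {..<card J}"
  proof -
    \<comment> \<open>A finite downward closed set of naturals ends just before its least missing
      element.\<close>
    have "J = {..<(LEAST n. n \<notin> J)}"
    proof (intro equalityI subsetI)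
      have ex: "(LEAST n. n \<notin> J) \<notin> J"
        using \<open>finite J\<close> by (metis LeastI_ex ex_new_if_finite infinite_UNIV_nat)
      fix x assume "x \<in> J"
      then show "x \<in> {..<(LEAST n. n \<notin> J)}"
        using ex \<open>\<And>m n. m \<in> J \<Longrightarrow> n < m \<Longrightarrow> n \<in> J\<close> by (metis lessThan_iff linorder_neqE_nat)
    next
      fix x assume "x \<in> {..<(LEAST n. n \<notin> J)}"
      then show "x \<in> J"
        using not_less_Least by blast
    qed
    then show ?thesis
      by (metis card_lessThan)
  qed
  moreover have "card J = card (A \<inter> {..<t})"
    unfolding J[symmetric] by (metis card_image inj_enumerate[OF assms] inj_on_subset subset_UNIV)
  ultimately have "enumerate A ` {..<card (A \<inter> {..<t})} = A \<inter> {..<t}"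
    using J by simp
  then show ?thesis
    by (intro strict_sorted_equal)
      (simp_all add: sorted_wrt_map assms atLeast0LessThan)
qed

lemma enumerate_periodic:
  fixes A :: "nat set"
  assumes "0 < p" and periodic: "\<And>x. x mod p \<in> A \<longleftrightarrow> x \<in> A"
    and L: "L = sorted_list_of_set (A \<inter> {..<p})" "L \<noteq> []"
  shows "infinite A" "enumerate A n = p * (n div length L) + L ! (n mod length L)"
proof -
  define m where "m = length L"
  have m: "0 < m"
    using L(2) m_def by simp
  have setL: "set L = A \<inter> {..<p}"
    by (simp add: L)
  have sortedL: "sorted_wrt (<) L"
    by (simp add: L)
  have nth: "L ! i < p" "L ! i \<in> A" if "i < m" for i
    using that setL nth_mem[of i L] unfolding m_def by auto
  let ?f = "\<lambda>n. p * (n div m) + L ! (n mod m)"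
  have mono: "strict_mono ?f"
    unfolding strict_mono_Suc_iff
  proof
    fix n
    show "?f n < ?f (Suc n)"
    \<comment> \<open>At the end of a block the next value lies in the next period, so
      \<open>L ! i < p\<close> suffices; inside a block the order of \<open>L\<close>
      decides.\<close>
    proof (cases "Suc (n mod m) = m")
      case True
      then show ?thesis
        using nth(1)[of "n mod m"] m by (simp add: mod_Suc div_Suc)
    next
      case False
      then have "Suc (n mod m) < m"
        using m by (simp add: Suc_lessI)
      then show ?thesis
        using sortedL m_def False by (simp add: mod_Suc div_Suc sorted_wrt_iff_nth_less)
    qed
  qed
  have range: "range ?f = A"
  proof (intro equalityI subsetI)
    fix x assume "x \<in> range ?f"
    then obtain n where n: "x = ?f n"
      by blast
    then have "x mod p = L ! (n mod m)"
      using nth(1) m by simp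
    then show "x \<in> A"
      using nth(2)[of "n mod m"] m periodic[of x] by simp
  next
    fix x assume "x \<in> A"
    then have "x mod p \<in> set L"
      using setL periodic[of x] \<open>0 < p\<close> by simp
    then obtain i where "i < m" "L ! i = x mod p"
      by (auto simp: in_set_conv_nth m_def)
    \<comment> \<open>The quotient of \<open>x\<close> selects the block, its residue the place
      \<open>i\<close> in the block.\<close>
    then have "x = ?f (m * (x div p) + i)"
      by simp
    then show "x \<in> range ?f"
      by (rule range_eqI)
  qed
  show "infinite A" "enumerate A n = p * (n div length L) + L ! (n mod length L)"
    using enumerate_eq_strict_mono[OF mono range] unfolding m_def by simp_all
qed

text \<open>Cut the initial segment into \<open>t div p\<close> full periods and a remainder that
  starts at a multiple of \<open>p\<close>; translation by such a multiple preserves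
  \<open>A\<close>.\<close>

lemma card_periodic_lessThan:
  fixes A :: "nat set"
  assumes periodic: "\<And>x. x mod p \<in> A \<longleftrightarrow> x \<in> A"
  shows "card (A \<inter> {..<t}) = t div p * card (A \<inter> {..<p}) + card (A \<inter> {..<t mod p})"
proof -
  have shift: "card (A \<inter> {p * q..<p * q + r}) = card (A \<inter> {..<r})" for q r
  proof -
    have "A \<inter> {p * q..<p * q + r} = (+) (p * q) ` (A \<inter> {..<r})"
    proof (intro equalityI subsetI)
      fix x assume x: "x \<in> A \<inter> {p * q..<p * q + r}"
      then have "(x - p * q) mod p = x mod p"
        by (metis IntD2 atLeastLessThan_iff le_add_diff_inverse mod_mult_self4 mult.commute)
      then have "x - p * q \<in> A"
        using x periodic by (metis IntD1)
      then show "x \<in> (+) (p * q) ` (A \<inter> {..<r})"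
        using x by (intro image_eqI[of _ _ "x - p * q"]) auto
    next
      fix x assume "x \<in> (+) (p * q) ` (A \<inter> {..<r})"
      then obtain y where y: "x = p * q + y" "y \<in> A" "y < r"
        by auto
      then have "x mod p = y mod p"
        by simp
      then show "x \<in> A \<inter> {p * q..<p * q + r}"
        using y periodic[of x] periodic[of y] by simp
    qed
    then show ?thesis
      by (simp add: card_image)
  qed
  have split: "card (A \<inter> {..<p * q + r}) = card (A \<inter> {..<p * q}) + card (A \<inter> {..<r})" for q r
  proof -
    have "A \<inter> {..<p * q + r} = A \<inter> {..<p * q} \<union> A \<inter> {p * q..<p * q + r}"
      by auto
    then show ?thesis
      using shift by (simp add: card_Un_disjoint disjoint_iff)
  qed
  have "card (A \<inter> {..<p * q}) = q * card (A \<inter> {..<p})" for q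
    by (induction q) (use split[of _ p] in \<open>simp_all add: add.commute\<close>)
  then show ?thesis
    using split[of "t div p" "t mod p"] by simp
qed

subsection \<open>The game with two moves\<close>

text \<open>There are finitely many options, so their mex is a value they omit; it is 0 exactly when
  no option has value 0.\<close>

lemma P_positions_iff:
  "x \<in> P_positions S \<longleftrightarrow> (\<forall>s\<in>S. 0 < s \<longrightarrow> s \<le> x \<longrightarrow> x - s \<notin> P_positions S)"
proof -
  have mex: "mex A = 0 \<longleftrightarrow> 0 \<notin> A" if "finite A" for A
  proof -
    have "mex A \<notin> A"
      unfolding mex_def using that by (metis LeastI_ex ex_new_if_finite infinite_UNIV_nat)
    moreover have "mex A = 0" if "0 \<notin> A"
      using that unfolding mex_def by simp
    ultimately show ?thesis
      by auto
  qed
  have "finite {s \<in> S. 0 < s \<and> s \<le> x}"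
    by (rule finite_subset[of _ "{..x}"]) auto
  then have "nim_value S x = 0 \<longleftrightarrow> 0 \<notin> (\<lambda>s. nim_value S (x - s)) ` {s \<in> S. 0 < s \<and> s \<le> x}"
    by (subst nim_value.simps) (simp add: mex)
  then show ?thesis
    unfolding P_positions_def by (auto simp: image_iff)
qed

text \<open>Moves decrease \<open>x\<close>, so the recursion has a unique solution: a proposed set
  of P-positions need only be checked against it.\<close>

lemma P_positions_eqI:
  assumes "\<And>x. x \<in> Q \<longleftrightarrow> (\<forall>s\<in>S. 0 < s \<longrightarrow> s \<le> x \<longrightarrow> x - s \<notin> Q)"
  shows "P_positions S = Q"
proof -
  have "x \<in> P_positions S \<longleftrightarrow> x \<in> Q" for x
  proof (induction x rule: less_induct)
    case (less x)
    then have "x - s \<in> P_positions S \<longleftrightarrow> x - s \<in> Q" if "0 < s" "s \<le> x" for s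
      using that by simp
    then show ?case
      using P_positions_iff[of x S] assms[of x] by blast
  qed
  then show ?thesis
    by blast
qed

text \<open>Modulo \<open>a + b\<close>, subtracting \<open>b\<close> is adding \<open>a\<close> and
  subtracting \<open>a\<close> is adding \<open>b\<close>. Hence no move joins two elements of
  \<open>?Q\<close>, and outside \<open>?Q\<close> some move enters it.\<close>

lemma P_positions_pair:
  assumes "0 < a" "a < b"
  shows "P_positions {a, b} = {x. x mod (a + b) < b \<and> x mod (a + b) mod (2 * a) < a}" (is "_ = ?Q")
proof (rule P_positions_eqI)
  fix x
  define q r where "q = x div (a + b)" and "r = x mod (a + b)"
  define k e where "k = r div (2 * a)" and "e = r mod (2 * a)"
  have x: "x = q * (a + b) + r"
    by (simp only: q_def r_def div_mult_mod_eq)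
  have r: "r < a + b"
    using assms unfolding r_def by simp
  have e: "r = k * (2 * a) + e" "e < 2 * a"
    using assms by (simp_all only: k_def e_def div_mult_mod_eq) simp
  have Q: "q' * (a + b) + r' \<in> ?Q \<longleftrightarrow> r' < b \<and> r' mod (2 * a) < a" if "r' < a + b" for q' r'
    using that by simp
  have xQ: "x \<in> ?Q \<longleftrightarrow> r < b \<and> e < a"
    unfolding r_def e_def by simp
  show "x \<in> ?Q \<longleftrightarrow> (\<forall>s\<in>{a, b}. 0 < s \<longrightarrow> s \<le> x \<longrightarrow> x - s \<notin> ?Q)"
  proof
    assume "x \<in> ?Q"
    then have re: "r < b" "e < a"
      using xQ by auto
    have "x - a \<notin> ?Q" if ax: "a \<le> x"
    proof (cases "a \<le> r")
      case True
      \<comment> \<open>As \<open>a \<le> r\<close> but \<open>e < a\<close>, there is an earlier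
        block of length \<open>2 * a\<close>; the move lands in its upper half.\<close>
      then obtain k' where "k = Suc k'"
        using e re by (cases k) auto
      then have ra: "r - a = k' * (2 * a) + (a + e)"
        using e by simp
      have "(r - a) mod (2 * a) = a + e"
        unfolding ra using re by simp
      then have "q * (a + b) + (r - a) \<notin> ?Q"
        using Q[of "r - a" q] r by simp
      moreover have "x - a = q * (a + b) + (r - a)"
        using x True by simp
      ultimately show ?thesis
        by simp
    next
      case False
      \<comment> \<open>Here \<open>r < a\<close>, so the move borrows a period and reaches residue
        \<open>r + b\<close>, outside the allowed range.\<close>
      then obtain q' where "q = Suc q'"
        using x ax False by (cases q) auto
      then have "x - a = q' * (a + b) + (r + b)"
        using x by simp
      then show ?thesis
        using Q[of "r + b" q'] False by simp
    qed
    moreover have "x - b \<notin> ?Q" if bx: "b \<le> x"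
    proof -
      \<comment> \<open>Since \<open>r < b\<close>, the move borrows a period; residue
        \<open>r + a\<close> then falls in the upper half of its block.\<close>
      obtain q' where "q = Suc q'"
        using x bx re by (cases q) auto
      then have "x - b = q' * (a + b) + (r + a)"
        using x by simp
      moreover have ra: "r + a = k * (2 * a) + (e + a)"
        using e by simp
      have "(r + a) mod (2 * a) = e + a"
        unfolding ra using re by simp
      ultimately show ?thesis
        using Q[of "r + a" q'] re by simp
    qed
    ultimately show "\<forall>s\<in>{a, b}. 0 < s \<longrightarrow> s \<le> x \<longrightarrow> x - s \<notin> ?Q"
      by blast
  next
    assume moves: "\<forall>s\<in>{a, b}. 0 < s \<longrightarrow> s \<le> x \<longrightarrow> x - s \<notin> ?Q"
    \<comment> \<open>Otherwise removing \<open>b\<close> leaves a residue below \<open>a\<close>,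
      which is in \<open>?Q\<close>.\<close>
    have "r < b"
    proof (rule ccontr)
      assume "\<not> r < b"
      then have "x - b = q * (a + b) + (r - b)" "b \<le> x" "r - b < a"
        using x r by simp_all
      then have "x - b \<in> ?Q"
        using Q[of "r - b" q] assms by simp
      then show False
        using moves \<open>b \<le> x\<close> assms by simp
    qed
    \<comment> \<open>Otherwise removing \<open>a\<close> moves from the upper to the lower half of
      the same block.\<close>
    moreover have "e < a"
    proof (rule ccontr)
      assume "\<not> e < a"
      then have "r - a = k * (2 * a) + (e - a)" "e - a < a" "a \<le> r"
        using e by simp_all
      then have "x - a = q * (a + b) + (r - a)" "a \<le> x" "(r - a) mod (2 * a) < a"
        using x by simp_all
      then have "x - a \<in> ?Q"
        using Q[of "r - a" q] \<open>r < b\<close> by simp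
      then show False
        using moves \<open>a \<le> x\<close> assms by simp
    qed
    ultimately show "x \<in> ?Q"
      using xQ by simp
  qed
qed

lemma mod_P_positions_pair_iff:
  assumes "0 < a" "a < b"
  shows "x mod (a + b) \<in> P_positions {a, b} \<longleftrightarrow> x \<in> P_positions {a, b}"
  using P_positions_pair[OF assms] by simp

section \<open>Counting and listing the P-positions of one and two moves\<close>

lemma card_mod_less:
  assumes "0 < a"
  shows "card ({x. x mod (2 * a) < a} \<inter> {..<t}) = C_count a t"
proof -
  have initial: "{x. x mod (2 * a) < a} \<inter> {..<r} = {..<min a r}" if "r \<le> 2 * a" for r
    using that by auto
  have "card ({x. x mod (2 * a) < a} \<inter> {..<t}) =
      t div (2 * a) * card ({x. x mod (2 * a) < a} \<inter> {..<2 * a}) +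
      card ({x. x mod (2 * a) < a} \<inter> {..<t mod (2 * a)})"
    by (rule card_periodic_lessThan) simp
  then show ?thesis
    using assms initial[of "2 * a"] initial[of "t mod (2 * a)"]
    by (simp add: C_count_def mult.commute)
qed

lemma enumerate_mod_less:
  assumes "0 < a"
  shows "infinite {x. x mod (2 * a) < a}" "enumerate {x. x mod (2 * a) < a} n = w1 a n"
proof -
  have "{x. x mod (2 * a) < a} \<inter> {..<2 * a} = {0..<a}"
    by auto
  then have L: "[0..<a] = sorted_list_of_set ({x. x mod (2 * a) < a} \<inter> {..<2 * a})"
    by simp
  note enum = enumerate_periodic[OF _ _ L]
  show "infinite {x. x mod (2 * a) < a}"
    by (rule enum) (use assms in auto)
  have "enumerate {x. x mod (2 * a) < a} n =
      2 * a * (n div length [0..<a]) + [0..<a] ! (n mod length [0..<a])"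
    by (rule enum) (use assms in auto)
  \<comment> \<open>Halving the factor \<open>2 * a\<close> makes the bracket collapse to
    \<open>n\<close>.\<close>
  also have "\<dots> = a * (n div a) + (a * (n div a) + n mod a)"
    using assms by simp
  finally show "enumerate {x. x mod (2 * a) < a} n = w1 a n"
    by (simp add: w1_def)
qed

text \<open>Below \<open>a + b\<close> each number is its own residue, so the game looks like that
  of \<open>{a}\<close> cut off at \<open>b\<close>. This is the source of
  \<open>min (rho a b c) b\<close> in \<open>Nc_count\<close>.\<close>

lemma P_positions_pair_lessThan:
  assumes "0 < a" "a < b" "t \<le> a + b"
  shows "P_positions {a, b} \<inter> {..<t} = {x. x mod (2 * a) < a} \<inter> {..<min t b}"
  using assms by (auto simp: P_positions_pair)

lemma card_P_positions_pair_lessThan: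
  assumes "0 < a" "a < b"
  shows "card (P_positions {a, b} \<inter> {..<c}) = Nc_count a b c"
proof -
  have "card (P_positions {a, b} \<inter> {..<c}) =
      c div (a + b) * card (P_positions {a, b} \<inter> {..<a + b}) +
      card (P_positions {a, b} \<inter> {..<c mod (a + b)})"
    by (rule card_periodic_lessThan) (rule mod_P_positions_pair_iff[OF assms])
  moreover have "c mod (a + b) \<le> a + b"
    using assms by (simp add: less_imp_le)
  ultimately show ?thesis
    using assms P_positions_pair_lessThan[OF assms, of "a + b"]
      P_positions_pair_lessThan[OF assms, of "c mod (a + b)"]
    by (simp add: card_mod_less Nc_count_def K_quot_def N_count_def rho_def)
qed

lemma enumerate_P_positions_pair:
  assumes "0 < a" "a < b"
  shows "infinite (P_positions {a, b})" "enumerate (P_positions {a, b}) n = w_B a b n"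
proof -
  let ?H = "{x. x mod (2 * a) < a}"
  have "P_positions {a, b} \<inter> {..<a + b} = ?H \<inter> {..<b}"
    using P_positions_pair_lessThan[OF assms, of "a + b"] by simp
  then have "sorted_list_of_set (P_positions {a, b} \<inter> {..<a + b}) =
      map (enumerate ?H) [0..<card (?H \<inter> {..<b})]"
    by (simp only: sorted_list_of_set_lessThan_enumerate[OF enumerate_mod_less(1)[OF assms(1)]])
  also have "\<dots> = map (w1 a) [0..<N_count a b]"
    using assms by (simp add: card_mod_less enumerate_mod_less N_count_def)
  finally have L: "map (w1 a) [0..<N_count a b] =
      sorted_list_of_set (P_positions {a, b} \<inter> {..<a + b})" ..
  \<comment> \<open>The position 0 makes the list of one period nonempty, so division by
    \<open>N_count a b\<close> is genuine.\<close>
  have "0 \<in> ?H \<inter> {..<b}"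
    using assms by simp
  then have N: "0 < N_count a b"
    unfolding N_count_def card_mod_less[OF assms(1), symmetric] by (metis card_gt_0_iff emptyE finite_Int finite_lessThan)
  note enum = enumerate_periodic[OF _ mod_P_positions_pair_iff[OF assms] L]
  show "infinite (P_positions {a, b})"
    by (rule enum) (use assms N in auto)
  have "enumerate (P_positions {a, b}) n =
      (a + b) * (n div length (map (w1 a) [0..<N_count a b])) +
      map (w1 a) [0..<N_count a b] ! (n mod length (map (w1 a) [0..<N_count a b]))"
    by (rule enum) (use assms N in auto)
  then show "enumerate (P_positions {a, b}) n = w_B a b n"
    using N by (simp add: w_B_def)
qed

lemma sorted_list_of_P_positions_pair_lessThan:
  assumes "0 < a" "a < b"
  shows "sorted_list_of_set (P_positions {a, b} \<inter> {..<c}) = map (w_B a b) [0..<Nc_count a b c]"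
  using sorted_list_of_set_lessThan_enumerate[OF enumerate_P_positions_pair(1)[OF assms], of c]
  by (simp add: card_P_positions_pair_lessThan enumerate_P_positions_pair assms)

subsection \<open>One period of the game with three moves\<close>

text \<open>The residue conditions become conditions on \<open>u\<close> and \<open>c + u\<close>
  themselves: \<open>u < b\<close> is its own residue, and \<open>rho a b c + u\<close> is congruent
  to \<open>c + u\<close> modulo the period.\<close>

lemma D_rho_iff:
  assumes "0 < a" "a < b"
  shows "u \<in> D_rho a b c \<longleftrightarrow>
    a \<le> u \<and> u < b \<and> u \<notin> P_positions {a, b} \<and> c + u \<in> P_positions {a, b}"
proof -
  have "(rho a b c + u) mod (a + b) = (c + u) mod (a + b)"
    by (simp add: rho_def mod_simps)
  then show ?thesis
    using assms mod_P_positions_pair_iff[OF assms, of "c + u"]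
    by (auto simp: D_rho_def D_set_def Z_set_def)
qed

lemma T_set_lessThan:
  assumes "0 < a" "a < b" "P \<in> {c + a, c + b}"
    and E: "E = (if P = c + a then {} else D_rho a b c)"
  shows "T_set a b c P \<inter> {..<P} = P_positions {a, b} \<inter> {..<c} \<union> (+) c ` E"
proof -
  have initial: "u \<in> P_positions {a, b}" if "u < a" for u
    using that assms by (simp add: P_positions_pair)
  \<comment> \<open>A non-P-position \<open>u\<close> is at least \<open>a\<close>. This contradicts
    \<open>u < a\<close> when \<open>P = c + a\<close>, and supplies the lower bound in
    \<open>D_rho\<close> when \<open>P = c + b\<close>.\<close>
  have PE: "c + u < P \<and> u \<notin> P_positions {a, b} \<and> c + u \<in> P_positions {a, b} \<longleftrightarrow> u \<in> E" for u
    using assms initial[of u] by (auto simp: D_rho_iff)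
  show ?thesis
  proof (rule set_eqI)
    fix x
    show "x \<in> T_set a b c P \<inter> {..<P} \<longleftrightarrow> x \<in> P_positions {a, b} \<inter> {..<c} \<union> (+) c ` E"
    proof (cases "x < c")
      case True
      then show ?thesis
        using assms(3) by (auto simp: T_set_def)
    next
      case False
      then obtain u where "x = c + u"
        by (metis le_Suc_ex not_less)
      then show ?thesis
        using PE[of u] by (auto simp: T_set_def image_iff)
    qed
  qed
qed

lemma sorted_list_of_T_set_lessThan:
  assumes "0 < a" "a < b" "P \<in> {c + a, c + b}"
    and E: "E = (if P = c + a then {} else D_rho a b c)"
  shows "sorted_list_of_set (T_set a b c P \<inter> {..<P}) =
    map (v_list a b c E) [0..<Nc_count a b c + card E]"
proof -
  let ?W = "P_positions {a, b} \<inter> {..<c}"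
  let ?es = "sorted_list_of_set E"
  have "finite (D_rho a b c)"
    by (simp add: D_rho_def D_set_def)
  then have fin: "finite E"
    using E by simp
  have "sorted_list_of_set (T_set a b c P \<inter> {..<P}) =
      sorted_list_of_set ?W @ map ((+) c) ?es"
  proof (rule strict_sorted_equal)
    \<comment> \<open>Entries of the first list are below \<open>c\<close>, those of the second at
      least \<open>c\<close>.\<close>
    show "sorted_wrt (<) (sorted_list_of_set ?W @ map ((+) c) ?es)"
      by (auto simp: sorted_wrt_append sorted_wrt_map fin)
  qed (use T_set_lessThan[OF assms] fin in simp_all)
  also have "\<dots> = map (v_list a b c E) [0..<Nc_count a b c + card E]"
    unfolding sorted_list_of_P_positions_pair_lessThan[OF assms(1,2)]
    by (rule nth_equalityI) (auto simp: nth_append v_list_def)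
  finally show ?thesis .
qed

theorem theorem31:
  fixes a b c :: nat
  assumes "2 \<le> a" and "a < b" and "b < c"
    and "Gcd {a, b, c} = 1" and "c \<noteq> a + b"
  shows "(\<forall>P E M.
      P \<in> {c + a, c + b} \<longrightarrow>
      P_positions {a, b, c} = T_set a b c P \<longrightarrow>
      E = (if P = c + a then {} else D_rho a b c) \<longrightarrow>
      M = Nc_count a b c + card E \<longrightarrow>
        P_positions {a, b, c} \<inter> {0..<P} = w_B a b ` {0..<Nc_count a b c} \<union> (+) c ` E \<and>
        w_B a b ` {0..<Nc_count a b c} \<inter> (+) c ` E = {} \<and>
        sorted_list_of_set (P_positions {a, b, c} \<inter> {0..<P}) = map (v_list a b c E) [0..<M] \<and>
        infinite (P_positions {a, b, c}) \<and>
        (\<forall>n. enumerate (P_positions {a, b, c}) n = P * (n div M) + v_list a b c E (n mod M)))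
    \<and> (P_positions {a, b, c} = P_positions {a, b} \<longrightarrow>
        infinite (P_positions {a, b, c}) \<and>
        (\<forall>n. enumerate (P_positions {a, b, c}) n = w_B a b n))"
\<comment> \<open>The instance splits only the outer conjunction, whose first conjunct is universal,
  and keeps the inner ones whole.\<close>
proof (intro conjI[of "All _"] allI impI)
  have ab: "0 < a" "a < b"
    using assms by simp_all
  fix P E M
  assume P: "P \<in> {c + a, c + b}"
    and T: "P_positions {a, b, c} = T_set a b c P"
    and E: "E = (if P = c + a then {} else D_rho a b c)"
    and M: "M = Nc_count a b c + card E"
  have "0 < P"
    using P ab by auto
  \<comment> \<open>Again 0 gives a nonempty period, so that \<open>M\<close> is a proper divisor
    for \<open>div\<close> and \<open>mod\<close>.\<close>
  have "0 \<in> P_positions {a, b} \<inter> {..<c}"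
    using assms by (simp add: P_positions_pair[OF ab])
  then have "0 < Nc_count a b c"
    unfolding card_P_positions_pair_lessThan[OF ab, symmetric]
    by (metis card_gt_0_iff emptyE finite_Int finite_lessThan)
  then have "0 < M"
    using M by simp
  have W: "P_positions {a, b} \<inter> {..<c} = w_B a b ` {0..<Nc_count a b c}"
    using arg_cong[OF sorted_list_of_P_positions_pair_lessThan[OF ab], of set] by simp
  have L: "map (v_list a b c E) [0..<M] = sorted_list_of_set (T_set a b c P \<inter> {..<P})"
    using sorted_list_of_T_set_lessThan[OF ab P E] M by simp
  have periodic: "x mod P \<in> T_set a b c P \<longleftrightarrow> x \<in> T_set a b c P" for x
    by (simp add: T_set_def)
  note enum = enumerate_periodic[OF \<open>0 < P\<close> periodic L]
  have inf: "infinite (T_set a b c P)"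
    by (rule enum) (use \<open>0 < M\<close> in simp)
  have "enumerate (T_set a b c P) n = P * (n div length (map (v_list a b c E) [0..<M])) +
      map (v_list a b c E) [0..<M] ! (n mod length (map (v_list a b c E) [0..<M]))" for n
    by (rule enum) (use \<open>0 < M\<close> in simp)
  then have nth: "\<forall>n. enumerate (T_set a b c P) n = P * (n div M) + v_list a b c E (n mod M)"
    using \<open>0 < M\<close> by simp
  have disj: "w_B a b ` {0..<Nc_count a b c} \<inter> (+) c ` E = {}"
    unfolding W[symmetric] by auto
  show "P_positions {a, b, c} \<inter> {0..<P} = w_B a b ` {0..<Nc_count a b c} \<union> (+) c ` E \<and>
      w_B a b ` {0..<Nc_count a b c} \<inter> (+) c ` E = {} \<and>
      sorted_list_of_set (P_positions {a, b, c} \<inter> {0..<P}) = map (v_list a b c E) [0..<M] \<and>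
      infinite (P_positions {a, b, c}) \<and>
      (\<forall>n. enumerate (P_positions {a, b, c}) n = P * (n div M) + v_list a b c E (n mod M))"
    unfolding T atLeast0LessThan[of P]
    using T_set_lessThan[OF ab P E] W L disj inf nth by simp
next
  assume "P_positions {a, b, c} = P_positions {a, b}"
  then show "infinite (P_positions {a, b, c}) \<and>
      (\<forall>n. enumerate (P_positions {a, b, c}) n = w_B a b n)"
    using enumerate_P_positions_pair[of a b] assms by simp
qed

end
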